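(* For a real number $N>1$ let $E=E(N)$ be the set of integers $1\le k\le N$ all of whose prime divisors are smaller than $\sqrt N$. Then there exists a constant $\alpha>0$ such that $$\#(E(N))>\alpha N\quad\text{for every } N>1 .$$ Moreover, for all sufficiently large $N$ one may take $\alpha=\ln(e/2)$, i.e. $\#(E(N))>N\ln(e/2)$.
   Context: $\#(\cdot)$ denotes cardinality. The integer $k=1$ has no prime divisors and hence belongs to $E(N)$. *)

theory Defs
  imports Complex_Main "HOL-Computational_Algebra.Primes"
begin

definition E :: "real \<Rightarrow> nat set" where
  "E N = {k. 1 \<le> k \<and> real k \<le> N \<and> (\<forall>p. prime p \<and> p dvd k \<longrightarrow> real p < sqrt N)}"

text \<open>Every \<open>E N\<close> is finite, so \<open>card (E N)\<close> is its true cardinality.\<close>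

lemma finite_E: "finite (E N)"
proof (rule finite_subset)
  show "E N \<subseteq> {..nat \<lfloor>N\<rfloor>}"
    by (auto simp: E_def le_nat_floor)
qed simp

end

theory Submission
  imports Defs "HOL-Analysis.Analysis" "HOL-Number_Theory.Prime_Powers"
    "HOL-Library.Discrete_Functions" "HOL-Real_Asymp.Real_Asymp"
begin

text \<open>
  An integer \<open>k \<le> N\<close> outside \<open>E N\<close> has a prime divisor \<open>p \<ge> sqrt N\<close>, so with \<open>X = \<lfloor>N\<rfloor>\<close> it suffices
  to bound \<open>S = \<Sum> \<Lambda> d / ln d * (X div d)\<close>, summed over \<open>d \<le> X\<close> with \<open>d * d \<ge> X\<close>, by a quantity
  slightly smaller than \<open>X ln 2\<close>.
  Mertens' theorem with error term \<open>O(1 / ln X)\<close> is not precise enough, because the gain is itself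
  of the order \<open>X / ln X\<close>; but the prime number theorem is not needed either.
  Put \<open>L = ln X\<close>, \<open>a = L / 2\<close> and expand \<open>1 / ln d\<close> around \<open>L\<close> to second order. Then \<open>S\<close> is expressed
  through \<open>ln (X!)\<close>, through \<open>\<Sum> \<Lambda> d / d * ln (x / d) = (ln x)\<^sup>2 / 2 - \<gamma> ln x + O(1)\<close>, which is
  elementary, and through \<open>\<Sum> \<Lambda> d / d\<close> over \<open>d < sqrt X\<close>, the only term not known to sufficient
  accuracy. If the last sum is at least \<open>a - \<kappa>\<close>, the outcome is
  \<open>S / X \<le> ln 2 + (2 \<kappa> - 1 - \<gamma>) / L + O(1 / L\<^sup>2)\<close>. The true value of \<open>\<kappa>\<close> is \<open>\<gamma>\<close>, but any
  \<open>\<kappa> < (1 + \<gamma>) / 2\<close> will do, and Chebyshev's device (a linear combination of the numbers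
  \<open>ln (\<lfloor>12 y / m\<rfloor>!)\<close>) provides \<open>\<kappa> = 0.787\<close>.
\<close>

subsection \<open>Factorials and the von Mangoldt function\<close>

abbreviation \<Lambda> :: "nat \<Rightarrow> real" where "\<Lambda> \<equiv> mangoldt"

text \<open>Since \<open>ln m\<close> is the sum of \<open>\<Lambda> d\<close> over the divisors
  \<open>d\<close> of \<open>m\<close>, writing \<open>m = d * k\<close> and swapping the sums
  suffices. The weight 1 leads to \<open>ln (n!)\<close>, the weight \<open>1 / m\<close> to the sum
  of \<open>ln m / m\<close>.\<close>

lemma sum_ln_mult_eq_sum_mangoldt:
  fixes F :: "nat \<Rightarrow> real"
  shows "(\<Sum>m=1..n. ln (real m) * F m) = (\<Sum>d=1..n. \<Lambda> d * (\<Sum>k=1..n div d. F (d * k)))"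
proof -
  have "(\<Sum>m=1..n. ln (real m) * F m) = (\<Sum>m=1..n. \<Sum>d | d dvd m. \<Lambda> d * F m)"
    by (intro sum.cong) (auto simp: mangoldt_sum[where ?'a = real, simplified, symmetric] sum_distrib_right)
  also have "\<dots> = (\<Sum>(m,d)\<in>(SIGMA m:{1..n}. {d. d dvd m}). \<Lambda> d * F m)"
    by (subst sum.Sigma) auto
  also have "\<dots> = (\<Sum>(d,k)\<in>(SIGMA d:{1..n}. {1..n div d}). \<Lambda> d * F (d * k))"
    by (rule sum.reindex_bij_witness[of _ "\<lambda>(d,k). (d * k, d)" "\<lambda>(m,d). (d, m div d)"])
       (auto simp: div_le_mono dvd_imp_le Suc_le_eq div_greater_zero_iff less_eq_div_iff_mult_less_eq mult.commute
             intro: dvd_pos_nat order.trans[OF dvd_imp_le])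
  also have "\<dots> = (\<Sum>d=1..n. \<Lambda> d * (\<Sum>k=1..n div d. F (d * k)))"
    by (subst sum.Sigma[symmetric]) (auto simp: sum_distrib_left)
  finally show ?thesis .
qed

text \<open>Legendre's formula. Terms with \<open>d > m\<close> vanish, so a common upper limit
  \<open>K\<close> allows several factorials to be combined term by term.\<close>

lemma ln_fact_eq_sum_mangoldt:
  assumes "m \<le> K"
  shows "ln (fact m :: real) = (\<Sum>d=1..K. \<Lambda> d * real (m div d))"
proof -
  have "ln (fact m :: real) = (\<Sum>k=1..m. ln (real k) * 1)"
    unfolding fact_prod of_nat_prod by (subst ln_prod) auto
  also have "\<dots> = (\<Sum>d=1..m. \<Lambda> d * real (m div d))"
    by (subst sum_ln_mult_eq_sum_mangoldt) simp
  also have "\<dots> = (\<Sum>d=1..K. \<Lambda> d * real (m div d))"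
    using assms by (intro sum.mono_neutral_left) auto
  finally show ?thesis .
qed

lemma ln_Suc_diff:
  assumes "m > 0"
  shows "1 / real (Suc m) \<le> ln (real (Suc m)) - ln (real m)" "ln (real (Suc m)) - ln (real m) \<le> 1 / real m"
proof -
  have "ln (real m / real (Suc m)) \<le> real m / real (Suc m) - 1"
    using assms by (intro ln_le_minus_one) auto
  also have "\<dots> = - (1 / real (Suc m))" by (simp add: field_simps)
  finally show "1 / real (Suc m) \<le> ln (real (Suc m)) - ln (real m)"
    using assms by (simp add: ln_div)
  have "ln (real (Suc m) / real m) \<le> real (Suc m) / real m - 1"
    using assms by (intro ln_le_minus_one) auto
  also have "\<dots> = 1 / real m" using assms by (simp add: field_simps)
  finally show "ln (real (Suc m)) - ln (real m) \<le> 1 / real m"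
    using assms by (simp add: ln_div)
qed

text \<open>Stirling's formula up to O(ln m), by induction from \<open>m * (ln (m + 1) - ln m) \<le>
  1 \<le> (m + 1) * (ln (m + 1) - ln m)\<close>.\<close>

lemma ln_fact_bounds:
  assumes "m \<ge> 1"
  shows "real m * ln (real m) - real m \<le> ln (fact m)"
    and "ln (fact m) \<le> real m * ln (real m) - real m + ln (real m) + 1"
proof -
  have "real m * ln (real m) - real m \<le> ln (fact m) \<and> ln (fact m) \<le> real m * ln (real m) - real m + ln (real m) + 1"
    using assms
  proof (induction m rule: dec_induct)
    case (step m)
    let ?a = "ln (real m)" and ?b = "ln (real (Suc m))"
    have f: "ln (fact (Suc m) :: real) = ?b + ln (fact m)"
      by (simp add: ln_mult del: of_nat_Suc)
    have "real m * (?b - ?a) \<le> real m * (1 / real m)"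
      using step.hyps by (intro mult_left_mono ln_Suc_diff) auto
    hence 1: "real m * ?b - real m * ?a \<le> 1" using step.hyps by (simp add: algebra_simps)
    have "real (Suc m) * (1 / real (Suc m)) \<le> real (Suc m) * (?b - ?a)"
      using step.hyps by (intro mult_left_mono ln_Suc_diff) auto
    hence 2: "1 \<le> real (Suc m) * ?b - real (Suc m) * ?a" by (simp add: algebra_simps)
    have r: "real (Suc m) = real m + 1" by simp
    show ?case
      using step.IH 1 2 unfolding f by (simp add: algebra_simps)
  qed auto
  thus "real m * ln (real m) - real m \<le> ln (fact m)"
       "ln (fact m) \<le> real m * ln (real m) - real m + ln (real m) + 1" by auto
qed

text \<open>The function \<open>z * ln z - z\<close> has derivative \<open>ln z\<close>, so
  replacing \<open>m\<close>, the floor of \<open>z\<close>, by \<open>z\<close> raises it by at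
  most \<open>ln z\<close>.\<close>

lemma ln_fact_floor_bounds:
  assumes "real m \<le> z" "z < real m + 1" "m \<ge> 1"
  shows "\<bar>ln (fact m) - (z * ln z - z)\<bar> \<le> ln z + 1"
proof -
  have z: "z \<ge> 1" "real m > 0" using assms by auto
  have "ln (real m / z) \<le> real m / z - 1" using assms by (intro ln_le_minus_one) auto
  hence "z * (ln (real m) - ln z) \<le> z * (real m / z - 1)"
    using z by (intro mult_left_mono) (auto simp: ln_div)
  also have "\<dots> = real m - z" using z by (simp add: field_simps)
  finally have 1: "z * ln (real m) - z * ln z \<le> real m - z" by (simp only: right_diff_distrib)
  have "ln (z / real m) \<le> z / real m - 1" using assms z by (intro ln_le_minus_one) auto
  hence "real m * (ln z - ln (real m)) \<le> real m * (z / real m - 1)"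
    using z by (intro mult_left_mono) (auto simp: ln_div)
  also have "\<dots> = z - real m" using z by (simp add: field_simps)
  finally have 2: "real m * ln z - real m * ln (real m) \<le> z - real m" by (simp only: right_diff_distrib)
  have 3: "real m * ln (real m) - real m \<le> z * ln z - z"
  proof -
    have "(z - real m) * ln (real m) \<ge> 0" using assms by (intro mult_nonneg_nonneg) auto
    thus ?thesis using 1 by (simp add: algebra_simps)
  qed
  have 4: "z * ln z - z - ln z \<le> real m * ln (real m) - real m"
  proof -
    have "(z - real m) * ln z \<le> 1 * ln z" using assms z by (intro mult_right_mono) auto
    thus ?thesis using 2 by (simp add: algebra_simps)
  qed
  have "ln (real m) \<le> ln z" using assms z by simp
  thus ?thesis using 3 4 ln_fact_bounds[OF assms(3)] z unfolding abs_le_iff by linarith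
qed

text \<open>Chebyshev's upper bound by halving: the logarithm of \<open>n! / (m!)^2\<close> with
  \<open>m = n div 2\<close> controls the sum over \<open>m < d \<le> n\<close>, and induction
  handles \<open>d \<le> m\<close>, because \<open>5 * m + n \<le> 4 * n\<close>.\<close>

lemma sum_mangoldt_le:
  "(\<Sum>d=1..n. \<Lambda> d) \<le> 4 * real n"
proof (induction n rule: less_induct)
  case (less n)
  show ?case
  proof (cases "n = 0")
    case False
    define m where "m = n div 2"
    have m: "m < n" "n - m \<le> Suc m" "m \<le> n" using False by (auto simp: m_def)
    have "(fact n :: real) = real (n choose m) * fact m * fact (n - m)"
      using m(3) by (simp add: binomial_fact)
    \<comment> \<open>The factor \<open>Suc m\<close> allows for odd \<open>n\<close>, where
      \<open>n - m = m + 1\<close>.\<close>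
    also have "\<dots> \<le> 2 ^ n * fact m * (real (Suc m) * fact m)"
    proof (intro mult_mono)
      have "n choose m \<le> 2 ^ n" by (rule binomial_le_pow2)
      thus "real (n choose m) \<le> 2 ^ n" by (metis of_nat_le_iff of_nat_numeral of_nat_power)
      have "(fact (n - m) :: real) \<le> fact (Suc m)" using m by (intro fact_mono) auto
      thus "fact (n - m) \<le> real (Suc m) * fact m" by simp
    qed auto
    finally have "ln (fact n :: real) \<le> ln (2 ^ n * fact m * (real (Suc m) * fact m))"
      by (subst ln_le_cancel_iff) (auto intro!: mult_pos_pos)
    also have "\<dots> = real n * ln 2 + 2 * ln (fact m) + ln (real (Suc m))"
      by (simp add: ln_mult ln_realpow del: of_nat_Suc)
    also have "\<dots> \<le> real n * 1 + 2 * ln (fact m) + real m"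
      using ln_2_less_1 ln_le_minus_one[of "real (Suc m)"] by (intro add_mono mult_left_mono) auto
    finally have 1: "ln (fact n :: real) - 2 * ln (fact m) \<le> real n + real m" by simp
    have "(\<Sum>d=1..n. \<Lambda> d) - (\<Sum>d=1..m. \<Lambda> d) = (\<Sum>d\<in>{1..n} - {1..m}. \<Lambda> d)"
      using m by (subst sum_diff) auto
    also have "\<dots> = (\<Sum>d\<in>{1..n}. \<Lambda> d * (if m < d then 1 else 0))"
      by (intro sum.mono_neutral_cong_left) auto
    \<comment> \<open>The new factor is never negative, and for \<open>m < d \<le> n\<close> it
      equals \<open>n div d\<close>, hence is at least 1.\<close>
    also have "\<dots> \<le> (\<Sum>d\<in>{1..n}. \<Lambda> d * (real (n div d) - 2 * real (m div d)))"
    proof (intro sum_mono mult_left_mono)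
      fix d assume d: "d \<in> {1..n}"
      have "2 * (m div d) \<le> n div d"
      proof -
        have "2 * (m div d * d) \<le> 2 * m" by (intro mult_le_mono2 div_times_less_eq_dividend)
        also have "\<dots> \<le> n" unfolding m_def by (rule times_div_less_eq_dividend)
        finally have "2 * (m div d) * d \<le> n" by (simp only: mult.assoc)
        thus ?thesis using d by (subst less_eq_div_iff_mult_less_eq) auto
      qed
      hence "2 * real (m div d) \<le> real (n div d)" by linarith
      moreover have "1 \<le> n div d" using d by (simp add: Suc_le_eq div_greater_zero_iff)
      ultimately show "(if m < d then 1 else 0) \<le> real (n div d) - 2 * real (m div d)"
        by (cases "m < d") simp_all
    qed (auto simp: mangoldt_nonneg)
    also have "\<dots> = ln (fact n) - 2 * ln (fact m)"
      using m by (simp add: ln_fact_eq_sum_mangoldt[of _ n] sum_subtractf sum_distrib_left algebra_simps)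
    finally have "(\<Sum>d=1..n. \<Lambda> d) \<le> (\<Sum>d=1..m. \<Lambda> d) + real n + real m"
      using 1 by simp
    also have "\<dots> \<le> 5 * real m + real n" using less[of m] m by simp
    also have "real m \<le> real n / 2" unfolding m_def by linarith
    finally show ?thesis by simp
  qed auto
qed

subsection \<open>Mertens sums\<close>

definition mertens :: "nat \<Rightarrow> real" where "mertens n = (\<Sum>d=1..n. \<Lambda> d / real d)"

text \<open>Legendre's formula with the fractional parts of \<open>n / d\<close> kept exactly.
  Bounding them above by 1 gives Mertens' theorem; bounding them below by Chebyshev's combination
  gives the sharper lower bound.\<close>

lemma mult_mertens_eq:
  "real n * mertens n = ln (fact n) + (\<Sum>d=1..n. \<Lambda> d * (real (n mod d) / real d))"
proof -
  have "real n * mertens n = (\<Sum>d=1..n. \<Lambda> d * (real n / real d))"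
    by (simp add: mertens_def sum_distrib_left field_simps)
  also have "\<dots> = (\<Sum>d=1..n. \<Lambda> d * real (n div d) + \<Lambda> d * (real (n mod d) / real d))"
  proof (intro sum.cong refl)
    fix d assume "d \<in> {1..n}"
    moreover have "real n = real (n div d) * real d + real (n mod d)"
      by (simp flip: of_nat_mult of_nat_add)
    ultimately have "real n / real d = real (n div d) + real (n mod d) / real d"
      by (simp add: field_simps)
    thus "\<Lambda> d * (real n / real d) = \<Lambda> d * real (n div d) + \<Lambda> d * (real (n mod d) / real d)"
      by (simp add: ring_distribs)
  qed
  also have "\<dots> = ln (fact n) + (\<Sum>d=1..n. \<Lambda> d * (real (n mod d) / real d))"
    by (subst ln_fact_eq_sum_mangoldt[of n n]) (auto simp: sum.distrib)
  finally show ?thesis .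
qed

lemma mertens_bounds:
  assumes "n \<ge> 1"
  shows "\<bar>mertens n - ln (real n)\<bar> \<le> 4"
proof -
  have "(\<Sum>d=1..n. \<Lambda> d * (real (n mod d) / real d)) \<ge> 0"
    by (intro sum_nonneg mult_nonneg_nonneg) (auto simp: mangoldt_nonneg)
  moreover have "(\<Sum>d=1..n. \<Lambda> d * (real (n mod d) / real d)) \<le> (\<Sum>d=1..n. \<Lambda> d * 1)"
    by (intro sum_mono mult_left_mono) (auto simp: mangoldt_nonneg)
  ultimately have "real n * mertens n \<ge> real n * (ln n - 4)" "real n * mertens n \<le> real n * (ln n + 4)"
    using sum_mangoldt_le[of n] ln_fact_bounds[OF assms] ln_le_minus_one[of "real n"] assms
    unfolding mult_mertens_eq by (auto simp: algebra_simps)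
  thus ?thesis using assms by (subst (asm) (1 2) mult_le_cancel_left_pos) (auto simp: abs_le_iff)
qed

text \<open>Comparison with the integral of \<open>ln t / t\<close>. The error of each step is
  dominated by a difference of consecutive values of \<open>1 / n\<close> or
  \<open>(ln n + 2) / n\<close>, so the errors telescope.\<close>

lemma sum_ln_over_bounds:
  assumes "n \<ge> 1"
  shows "\<bar>(\<Sum>m=1..n. ln (real m) / real m) - (ln (real n))\<^sup>2 / 2\<bar> \<le> 2"
proof -
  \<comment> \<open>The constants 1 and -2 make both inequalities equalities at
    \<open>n = 1\<close>.\<close>
  have "(\<Sum>m=1..n. ln (real m) / real m) \<le> (ln (real n))\<^sup>2 / 2 + 1 - 1 / real n \<and>
        (ln (real n))\<^sup>2 / 2 - 2 + (ln (real n) + 2) / real n \<le> (\<Sum>m=1..n. ln (real m) / real m)"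
    using assms
  proof (induction n rule: dec_induct)
    case (step m)
    define a where "a = ln (real m)"
    define b where "b = ln (real (Suc m))"
    define x where "x = real m"
    have x: "x \<ge> 1" and Sx: "real (Suc m) = x + 1" using step.hyps by (auto simp: x_def)
    have d: "1 / (x + 1) \<le> b - a" "b - a \<le> 1 / x"
      using ln_Suc_diff[of m] step.hyps by (auto simp: a_def b_def x_def add.commute)
    have a: "a \<ge> 0" using step.hyps by (auto simp: a_def)
    have "1 / (x + 1) \<ge> 0" "1 / x \<le> 1" using x by auto
    hence b: "b \<ge> a" "b \<le> a + 1" using d by linarith+
    have D: "b\<^sup>2 / 2 - a\<^sup>2 / 2 = (b - a) * b - (b - a)\<^sup>2 / 2"
      by (simp add: power2_eq_square field_simps)
    have "b / (x + 1) \<le> (b - a) * b"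
      using mult_right_mono[OF d(1), of b] b a by simp
    moreover have "(b - a)\<^sup>2 / 2 \<le> (1 / x)\<^sup>2 / 2"
      using d b by (intro divide_right_mono power_mono) auto
    moreover have "(1 / x)\<^sup>2 / 2 \<le> 1 / x - 1 / (x + 1)"
    proof -
      have "x * (x + 1) \<le> x * (2 * x)" using x by (intro mult_left_mono) auto
      hence "1 / (x * (2 * x)) \<le> 1 / (x * (x + 1))" using x by (intro frac_le) auto
      also have "\<dots> = 1 / x - 1 / (x + 1)" using x by (simp add: field_simps)
      finally show ?thesis by (simp add: power2_eq_square)
    qed
    ultimately have U: "b / (x + 1) \<le> b\<^sup>2 / 2 - a\<^sup>2 / 2 + (1 / x - 1 / (x + 1))"
      using D by linarith
    have "(b - a) * b \<le> b / x" using mult_right_mono[OF d(2), of b] b a by simp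
    moreover have "(b - a)\<^sup>2 / 2 \<ge> 0" by simp
    ultimately have "b\<^sup>2 / 2 - a\<^sup>2 / 2 \<le> b / x" using D by linarith
    moreover have "b / x - b / (x + 1) = b / (x * (x + 1))" using x by (simp add: field_simps)
    moreover have "b / (x * (x + 1)) \<le> (a + 1) / (x * (x + 1))"
      using b x by (intro divide_right_mono) auto
    moreover have "(a + 1) / (x * (x + 1)) = (a + 2) / x - (a + 2 + 1 / x) / (x + 1)"
    proof -
      have "x \<noteq> 0" "x + 1 \<noteq> 0" using x by auto
      thus ?thesis by (simp add: divide_simps) (simp add: algebra_simps)
    qed
    moreover have "(a + 2 + 1 / x) / (x + 1) \<ge> (b + 2) / (x + 1)"
      using d x by (intro divide_right_mono) auto
    ultimately have "b\<^sup>2 / 2 - a\<^sup>2 / 2 - b / (x + 1) \<le> (a + 2) / x - (b + 2) / (x + 1)"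
      by linarith
    moreover have "ln x = a" "ln (x + 1) = b" by (simp_all add: a_def b_def x_def add.commute)
    ultimately show ?case using step.IH U
      by (simp add: Sx flip: x_def del: of_nat_Suc)
  qed auto
  moreover have "1 / real n \<ge> 0" "(ln (real n) + 2) / real n \<ge> 0" using assms by auto
  ultimately show ?thesis unfolding abs_le_iff by linarith
qed

lemma harm_minus_ln_bounds:
  assumes "real m \<le> z" "z < real m + 1" "m \<ge> 1"
  shows "\<bar>harm m - ln z - euler_mascheroni\<bar> \<le> 2 / z"
proof -
  obtain n where n: "m = Suc n" using assms by (cases m) auto
  have g: "(euler_mascheroni :: real) \<ge> harm m - ln (real (Suc m)) + 1 / real (2 * (Suc m))"
          "(euler_mascheroni :: real) \<le> harm m - ln (real (Suc m)) + 1 / real (2 * m)"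
    using euler_mascheroni_lower[of n] euler_mascheroni_upper[of n] by (simp_all add: n)
  have z: "z \<ge> 1" "real m \<ge> 1" using assms by auto
  have "ln (real m) \<le> ln z" "ln z \<le> ln (real (Suc m))"
    using assms z by auto
  moreover have "ln (real (Suc m)) - ln (real m) \<le> 1 / real m" using assms by (intro ln_Suc_diff) auto
  moreover have "1 / real (2 * Suc m) \<ge> 0" "1 / real (2 * m) \<le> 1 / real m" using z by (auto simp: field_simps)
  moreover have "1 / real m \<le> 2 / z" using assms z by (simp add: field_simps)
  ultimately show ?thesis using g unfolding abs_le_iff by linarith
qed

text \<open>This is the integral of \<open>mertens t / t\<close> over \<open>t\<close> from 1 to
  \<open>x\<close>, a smoothing that makes the term of order \<open>ln x\<close> accessible by
  elementary means.\<close>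

definition log_mertens :: "real \<Rightarrow> real" where
  "log_mertens x = (\<Sum>d=1..nat \<lfloor>x\<rfloor>. \<Lambda> d / real d * ln (x / real d))"

text \<open>The sum \<open>S\<close> of \<open>ln m / m\<close> is evaluated twice: directly, and as
  the sum of \<open>\<Lambda> d / d * harm (n div d)\<close>, where the harmonic number is
  \<open>ln (x / d) + \<gamma> + O(d / x)\<close>. By Chebyshev's upper bound the errors add up to
  O(1).\<close>

lemma log_mertens_bounds:
  assumes "x \<ge> 1"
  shows "\<bar>log_mertens x - ((ln x)\<^sup>2 / 2 - euler_mascheroni * ln x)\<bar> \<le> 17"
proof -
  define n where "n = nat \<lfloor>x\<rfloor>"
  have n: "n \<ge> 1" "real n \<le> x" "x < real n + 1" using assms unfolding n_def by linarith+
  define S where "S = (\<Sum>m=1..n. ln (real m) / real m)"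
  have S: "S = (\<Sum>d=1..n. \<Lambda> d / real d * harm (n div d))"
    unfolding S_def using sum_ln_mult_eq_sum_mangoldt[of "\<lambda>m. 1 / real m" n]
    by (simp add: harm_def sum_distrib_left field_simps)
  have "\<bar>S - log_mertens x - euler_mascheroni * mertens n\<bar> =
     \<bar>\<Sum>d=1..n. \<Lambda> d / real d * (harm (n div d) - ln (x / real d) - euler_mascheroni)\<bar>"
    unfolding S log_mertens_def mertens_def by (simp add: n_def sum_subtractf ring_distribs sum_distrib_left mult.commute)
  also have "\<dots> \<le> (\<Sum>d=1..n. \<bar>\<Lambda> d / real d * (harm (n div d) - ln (x / real d) - euler_mascheroni)\<bar>)"
    by (rule sum_abs)
  also have "\<dots> \<le> (\<Sum>d=1..n. \<Lambda> d / real d * (2 / (x / real d)))"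
  proof (rule sum_mono)
    fix d assume d: "d \<in> {1..n}"
    \<comment> \<open>Division by an integer does not see the fractional part of
      \<open>x\<close>.\<close>
    have fl: "\<lfloor>x / real d\<rfloor> = int (n div d)"
      using floor_divide_real_eq_div[of "int d" x] n d assms by (simp add: n_def zdiv_int)
    have "\<bar>harm (n div d) - ln (x / real d) - euler_mascheroni\<bar> \<le> 2 / (x / real d)"
    proof (rule harm_minus_ln_bounds)
      show "1 \<le> n div d" using d by (auto simp: Suc_le_eq div_greater_zero_iff)
      show "real (n div d) \<le> x / real d" "x / real d < real (n div d) + 1"
        using fl by linarith+
    qed
    thus "\<bar>\<Lambda> d / real d * (harm (n div d) - ln (x / real d) - euler_mascheroni)\<bar>
       \<le> \<Lambda> d / real d * (2 / (x / real d))"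
      unfolding abs_mult by (intro mult_mono) (auto simp: mangoldt_nonneg)
  qed
  also have "\<dots> = 2 / x * (\<Sum>d=1..n. \<Lambda> d)"
    by (simp add: sum_distrib_left mult.commute)
  also have "\<dots> \<le> 2 / x * (4 * x)"
    using sum_mangoldt_le[of n] n assms by (intro mult_left_mono) auto
  also have "\<dots> = 8" using assms by simp
  finally have 1: "\<bar>S - log_mertens x - euler_mascheroni * mertens n\<bar> \<le> 8" .
  have 2: "\<bar>S - (ln (real n))\<^sup>2 / 2\<bar> \<le> 2" unfolding S_def using n by (intro sum_ln_over_bounds)
  have g: "(euler_mascheroni :: real) \<ge> 0" "(euler_mascheroni :: real) \<le> 1"
    using euler_mascheroni_pos euler_mascheroni_less_13_over_22 by linarith+
  have "\<bar>euler_mascheroni * (mertens n - ln (real n))\<bar> \<le> 1 * 4"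
    unfolding abs_mult using mertens_bounds[of n] n g by (intro mult_mono) auto
  hence 3: "\<bar>euler_mascheroni * mertens n - euler_mascheroni * ln (real n)\<bar> \<le> 4" by (simp add: algebra_simps)
  have "ln (x / real n) \<le> x / real n - 1" using n by (intro ln_le_minus_one) auto
  also have "x / real n \<le> (real n + 1) / real n" using n by (intro divide_right_mono) auto
  also have "(real n + 1) / real n - 1 = 1 / real n" using n by (simp add: field_simps)
  finally have l: "ln x - ln (real n) \<le> 1 / real n" using n by (simp add: ln_div)
  have l0: "ln (real n) \<le> ln x" "0 \<le> ln (real n)" using n by auto
  have l1: "ln (real n) \<le> real n" using ln_le_minus_one[of "real n"] n by auto
  have "1 / real n \<le> 1" using n by auto
  have "\<bar>euler_mascheroni * (ln x - ln (real n))\<bar> \<le> 1 * 1"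
    unfolding abs_mult using l l0 g \<open>1 / real n \<le> 1\<close> by (intro mult_mono) auto
  hence 4: "\<bar>euler_mascheroni * ln x - euler_mascheroni * ln (real n)\<bar> \<le> 1" by (simp add: algebra_simps)
  have "(ln x)\<^sup>2 - (ln (real n))\<^sup>2 = (ln x - ln (real n)) * (ln x + ln (real n))"
    by (simp add: power2_eq_square algebra_simps)
  also have "\<dots> \<le> 1 / real n * (3 * real n)"
  proof (intro mult_mono l)
    have "ln x \<le> ln (real n) + 1" using l \<open>1 / real n \<le> 1\<close> by linarith
    thus "ln x + ln (real n) \<le> 3 * real n" using l1 n by linarith
  qed (use l0 in auto)
  also have "\<dots> = 3" using n by simp
  finally have 5: "(ln x)\<^sup>2 - (ln (real n))\<^sup>2 \<le> 3" .
  have 6: "(ln (real n))\<^sup>2 \<le> (ln x)\<^sup>2" using l0 by (intro power_mono) auto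
  \<comment> \<open>The errors add up to 8 + 2 + 4 + 1 + 3/2, which is below 17.\<close>
  show ?thesis using 1 2 3 4 5 6 unfolding abs_le_iff by linarith
qed

subsection \<open>A Chebyshev-type lower bound\<close>

text \<open>The combination \<open>\<Sum> e (t div a)\<close> came out of a linear program (and was scaled by 48):
  maximise \<open>- \<Sum> e ln a / a\<close> subject to \<open>\<Sum> e / a = 0\<close> and the upper bounds in \<open>cheb_ok\<close>, the
  moduli \<open>a\<close> being divisors of 2520. With \<open>t = 12 y div d\<close> those bounds say that the combination
  is at most 48 times the fractional part of \<open>y / d\<close> when \<open>d \<le> y\<close>, and nonpositive otherwise.\<close>

definition cheb_coeffs :: "(int \<times> int) list" where
  "cheb_coeffs = [(14, 8), (15, 4), (18, 12), (20, 8), (21, 4), (24, -36), (28, 8), (35, 8), (36, -40),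
    (40, 4), (45, 8), (60, -40), (63, 8), (72, 21), (84, -21), (120, 34), (126, -14), (140, -17),
    (180, 21), (210, -17), (252, 14), (420, 26), (2520, 45)]"

definition cheb :: "int \<Rightarrow> int" where
  "cheb t = (\<Sum>(a, e)\<leftarrow>cheb_coeffs. e * (t div a))"

definition cheb_ok :: "int \<Rightarrow> bool" where
  "cheb_ok t \<longleftrightarrow> cheb t \<le> (if t < 12 then 0 else 4 * (t mod 12))"

text \<open>One full period of \<open>cheb\<close> is verified by evaluation, in two ranges.\<close>

lemma cheb_ok_1: "list_all cheb_ok [0..1259]"
  by code_simp

lemma cheb_ok_2: "list_all cheb_ok [1260..2519]"
  by code_simp

lemma cheb_ok:
  assumes "0 \<le> t" "t < 2520"
  shows "cheb_ok t"
proof (cases "t \<le> 1259")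
  case True
  thus ?thesis using cheb_ok_1 assms unfolding list_all_iff set_upto by simp
next
  case False
  thus ?thesis using cheb_ok_2 assms unfolding list_all_iff set_upto by simp
qed

text \<open>Every modulus divides 2520, so the shift adds \<open>2520 * k\<close> times the sum of
  \<open>e / a\<close>, which is 0.\<close>

lemma cheb_periodic: "cheb (t + 2520 * k) = cheb t"
proof -
  have "\<forall>(a, e)\<in>set cheb_coeffs. a \<noteq> 0 \<and> a dvd 2520"
    by (simp add: cheb_coeffs_def)
  hence "(\<Sum>(a, e)\<leftarrow>cheb_coeffs. e * ((t + 2520 * k) div a)) =
        (\<Sum>(a, e)\<leftarrow>cheb_coeffs. e * (t div a) + k * (e * (2520 div a)))"
  proof (intro arg_cong[where f = sum_list] map_cong refl, clarify)
    fix a e assume "(a, e) \<in> set cheb_coeffs"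
    hence "a dvd 2520" "a \<noteq> 0"
      using \<open>\<forall>(a, e)\<in>set cheb_coeffs. a \<noteq> 0 \<and> a dvd 2520\<close> by auto
    then obtain b where b: "2520 = a * b" by (elim dvdE)
    have "(t + 2520 * k) div a = (t + a * (b * k)) div a" by (simp only: b mult.assoc)
    also have "\<dots> = t div a + b * k" using \<open>a \<noteq> 0\<close> by simp
    also have "b = 2520 div a" using \<open>a \<noteq> 0\<close> unfolding b by simp
    finally show "e * ((t + 2520 * k) div a) = e * (t div a) + k * (e * (2520 div a))"
      by (simp add: algebra_simps)
  qed
  also have "\<dots> = cheb t + k * (\<Sum>(a, e)\<leftarrow>cheb_coeffs. e * (2520 div a))"
    by (simp add: cheb_def case_prod_unfold sum_list_addf sum_list_const_mult)
  also have "(\<Sum>(a, e)\<leftarrow>cheb_coeffs. e * (2520 div a)) = 0"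
    by (simp add: cheb_coeffs_def)
  finally show ?thesis by (simp add: cheb_def)
qed

text \<open>The bound is periodic as well, since 12 divides 2520. The stricter bound 0 holds only
  for \<open>t < 12\<close> itself and does not carry over to later periods.\<close>

lemma cheb_le:
  assumes "0 \<le> t"
  shows "cheb t \<le> 4 * (t mod 12)"
proof -
  have "cheb t = cheb (t mod 2520 + 2520 * (t div 2520))" by simp
  also have "\<dots> = cheb (t mod 2520)" by (rule cheb_periodic)
  also have "\<dots> \<le> 4 * ((t mod 2520) mod 12)"
    using cheb_ok[of "t mod 2520"] by (auto simp: cheb_ok_def split: if_splits)
  also have "(t mod 2520) mod 12 = t mod 12" by (simp add: mod_mod_cancel)
  finally show ?thesis .
qed

lemma cheb_nonpos:
  assumes "0 \<le> t" "t < 12"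
  shows "cheb t \<le> 0"
  using cheb_ok[of t] assms by (simp add: cheb_ok_def)

text \<open>With \<open>r = y mod d\<close>, the residue of \<open>12 * y div d\<close> modulo 12 is
  \<open>12 * r div d\<close>; multiplied by 4 it is at most \<open>48 * r / d\<close>. For
  \<open>d > y\<close> the quotient is below 12.\<close>

lemma cheb_div_le:
  assumes "d \<ge> 1"
  shows "real_of_int (cheb (int (12 * y div d))) \<le> (if d \<le> y then 48 * (real (y mod d) / real d) else 0)"
proof (cases "d \<le> y")
  case True
  define q r where "q = y div d" and "r = y mod d"
  have r: "r < d" "y = q * d + r" using assms by (auto simp: q_def r_def)
  have "12 * y div d = (12 * r + d * (12 * q)) div d" by (simp add: r(2) algebra_simps)
  also have "\<dots> = 12 * q + 12 * r div d" using assms by (subst div_mult_self2) auto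
  finally have "12 * y div d mod 12 = 12 * r div d mod 12" by simp
  also have "\<dots> = 12 * r div d" using r by (intro mod_less) (simp add: div_less_iff_less_mult)
  finally have "int (12 * y div d) mod 12 = int (12 * r div d)" by (metis of_nat_mod of_nat_numeral)
  hence "cheb (int (12 * y div d)) \<le> 4 * int (12 * r div d)"
    using cheb_le[of "int (12 * y div d)"] by simp
  hence "real_of_int (cheb (int (12 * y div d))) \<le> 4 * real (12 * r div d)" by linarith
  also have "real (12 * r div d) \<le> real (12 * r) / real d" by (rule of_nat_div_le_of_nat)
  finally show ?thesis using True by (simp add: r_def)
next
  case False
  hence "12 * y div d < 12" using assms by (simp add: div_less_iff_less_mult)
  hence "cheb (int (12 * y div d)) \<le> 0" by (intro cheb_nonpos) auto
  thus ?thesis using False by simp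
qed

definition cheb_sum :: "nat \<Rightarrow> real" where
  "cheb_sum y = (\<Sum>(a, e)\<leftarrow>cheb_coeffs. real_of_int e * ln (fact (12 * y div nat a)))"

lemma sum_list_sum_mult:
  fixes L :: "nat \<Rightarrow> real"
  shows "(\<Sum>(a, e)\<leftarrow>xs. real_of_int e * (\<Sum>d\<in>D. L d * real_of_int (h a d))) =
    (\<Sum>d\<in>D. L d * real_of_int (\<Sum>(a, e)\<leftarrow>xs. e * h a d))"
  by (induction xs) (auto simp: sum.distrib sum_distrib_left algebra_simps)

text \<open>Legendre's formula is applied to each factorial; the nested divisions by
  \<open>a\<close> and \<open>d\<close> commute.\<close>

lemma cheb_sum_eq:
  "cheb_sum y = (\<Sum>d=1..12*y. \<Lambda> d * real_of_int (cheb (int (12 * y div d))))"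
proof -
  have pos: "\<forall>(a, e)\<in>set cheb_coeffs. a > 0" by (simp add: cheb_coeffs_def)
  have "cheb_sum y = (\<Sum>(a, e)\<leftarrow>cheb_coeffs. real_of_int e *
      (\<Sum>d=1..12*y. \<Lambda> d * real_of_int (int (12 * y div d) div a)))"
    unfolding cheb_sum_def
  proof (intro arg_cong[where f = sum_list] map_cong refl, clarify)
    fix a e assume "(a, e) \<in> set cheb_coeffs"
    hence a: "int (nat a) = a" using pos by auto
    have *: "real (12 * y div nat a div d) = real_of_int (int (12 * y div d) div a)" for d
    proof -
      have "12 * y div nat a div d = 12 * y div d div nat a"
        by (simp only: div_mult2_eq[symmetric] mult.commute[of d])
      hence "int (12 * y div nat a div d) = int (12 * y div d) div a" by (simp only: of_nat_div a)
      thus ?thesis by (metis of_int_of_nat_eq)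
    qed
    have "ln (fact (12 * y div nat a)) = (\<Sum>d=1..12*y. \<Lambda> d * real (12 * y div nat a div d))"
      by (intro ln_fact_eq_sum_mangoldt div_le_dividend)
    also have "\<dots> = (\<Sum>d=1..12*y. \<Lambda> d * real_of_int (int (12 * y div d) div a))"
      by (simp only: *)
    finally show "real_of_int e * ln (fact (12 * y div nat a)) =
       real_of_int e * (\<Sum>d=1..12*y. \<Lambda> d * real_of_int (int (12 * y div d) div a))" by simp
  qed
  thus ?thesis by (simp only: sum_list_sum_mult cheb_def)
qed

text \<open>The right-hand side is 48 times the weighted sum of the fractional parts of
  \<open>y / d\<close>, which \<open>cheb\<close> minorises termwise. A lower bound for the
  factorials thus becomes one for \<open>mertens\<close>.\<close>

lemma cheb_sum_le: "cheb_sum y \<le> 48 * (real y * mertens y - ln (fact y))"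
proof -
  have "cheb_sum y \<le> (\<Sum>d=1..12*y. \<Lambda> d * (if d \<le> y then 48 * (real (y mod d) / real d) else 0))"
    unfolding cheb_sum_eq by (intro sum_mono mult_left_mono cheb_div_le) (auto simp: mangoldt_nonneg)
  also have "\<dots> = (\<Sum>d=1..y. \<Lambda> d * (48 * (real (y mod d) / real d)))"
    by (intro sum.mono_neutral_cong_right) auto
  also have "\<dots> = 48 * (\<Sum>d=1..y. \<Lambda> d * (real (y mod d) / real d))"
    by (simp add: sum_distrib_left algebra_simps)
  also have "\<dots> = 48 * (real y * mertens y - ln (fact y))"
    by (simp add: mult_mertens_eq)
  finally show ?thesis .
qed

section \<open>Asymptotics of the Chebyshev combination\<close>

lemma ln_fact_div_asymp:
  assumes "a > 0"
  shows "(\<lambda>y. ln (fact (12 * y div a)) / real y - 12 / real a * (ln (real y) + ln (12 / real a) - 1)) \<longlonglongrightarrow> 0"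
proof (rule Lim_null_comparison)
  show "\<forall>\<^sub>F y in sequentially.
    norm (ln (fact (12 * y div a)) / real y - 12 / real a * (ln (real y) + ln (12 / real a) - 1))
      \<le> (ln (12 * real y / real a) + 1) / real y"
    using eventually_ge_at_top[of a]
  proof eventually_elim
    case (elim y)
    define z where "z = 12 * real y / real a"
    define m where "m = 12 * y div a"
    have y: "real y > 0" using elim assms by auto
    have fl: "\<lfloor>z\<rfloor> = int m"
      using floor_divide_of_nat_eq[of "12 * y" a, where ?'a = real] by (simp add: z_def m_def)
    have "\<bar>ln (fact m) - (z * ln z - z)\<bar> \<le> ln z + 1"
    proof (rule ln_fact_floor_bounds)
      show "real m \<le> z" "z < real m + 1" using fl by linarith+
      show "1 \<le> m" using elim assms by (simp add: m_def Suc_le_eq div_greater_zero_iff)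
    qed
    hence "\<bar>ln (fact m) - (z * ln z - z)\<bar> / real y \<le> (ln z + 1) / real y"
      using y by (intro divide_right_mono) auto
    note le = this
    have "ln z = ln (real y) + ln (12 / real a)"
      using y assms by (simp add: z_def ln_mult ln_div)
    moreover have "z * ln z - z = real y * (12 / real a * (ln z - 1))"
      by (simp add: z_def algebra_simps)
    ultimately have "(ln (fact m) - (z * ln z - z)) / real y =
        ln (fact m) / real y - 12 / real a * (ln (real y) + ln (12 / real a) - 1)"
      using y by (simp add: diff_divide_distrib)
    moreover have "\<bar>ln (fact m) - (z * ln z - z)\<bar> / real y = \<bar>(ln (fact m) - (z * ln z - z)) / real y\<bar>"
      by (simp add: abs_divide)
    ultimately show ?case unfolding real_norm_def m_def[symmetric] z_def[symmetric] using le by simp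
  qed
  show "(\<lambda>y. (ln (12 * real y / real a) + 1) / real y) \<longlonglongrightarrow> 0"
    using assms by real_asymp
qed

lemma tendsto_sum_list_null:
  fixes f :: "'b \<Rightarrow> 'c \<Rightarrow> real"
  assumes "\<And>x. x \<in> set xs \<Longrightarrow> (f x \<longlongrightarrow> 0) F"
  shows "((\<lambda>y. \<Sum>x\<leftarrow>xs. f x y) \<longlongrightarrow> 0) F"
  using assms by (induction xs) (auto intro!: tendsto_add_zero)

text \<open>As the sum of \<open>e / a\<close> is 0, this is 12 times the objective value of the
  linear program.\<close>

definition cheb_const :: real where
  "cheb_const = (\<Sum>(a, e)\<leftarrow>cheb_coeffs. real_of_int e * (12 / real_of_int a) * ln (12 / real_of_int a))"

text \<open>In Stirling's main terms the part \<open>ln y - 1\<close> is multiplied by the sum of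
  \<open>12 * e / a\<close>, which is 0, so only the constants \<open>ln (12 / a)\<close>
  survive.\<close>

lemma cheb_sum_asymp: "(\<lambda>y. cheb_sum y / real y) \<longlonglongrightarrow> cheb_const"
proof -
  have pos: "\<forall>(a, e)\<in>set cheb_coeffs. a > 0" by (simp add: cheb_coeffs_def)
  let ?D = "\<lambda>a y. ln (fact (12 * y div nat a)) / real y
              - 12 / real (nat a) * (ln (real y) + ln (12 / real (nat a)) - 1)"
  have "cheb_sum y / real y - cheb_const = (\<Sum>(a, e)\<leftarrow>cheb_coeffs. real_of_int e * ?D a y)" for y
  proof -
    have "(\<Sum>(a, e)\<leftarrow>cheb_coeffs. real_of_int e * ?D a y) = 
      (\<Sum>(a, e)\<leftarrow>cheb_coeffs. real_of_int e * ln (fact (12 * y div nat a)) / real y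
         - real_of_int e * (12 / real_of_int a) * ln (12 / real_of_int a)
         - (real_of_int e * (12 / real_of_int a)) * (ln (real y) - 1))"
    proof (intro arg_cong[where f = sum_list] map_cong refl, clarify)
      fix a e assume "(a, e) \<in> set cheb_coeffs"
      hence a: "real (nat a) = real_of_int a" using pos by auto
      have *: "x * (f / u - c * (l + k - 1)) = x * f / u - x * c * k - (x * c) * (l - 1)"
        for x f u c l k :: real by (simp add: algebra_simps)
      show "real_of_int e * ?D a y = real_of_int e * ln (fact (12 * y div nat a)) / real y
         - real_of_int e * (12 / real_of_int a) * ln (12 / real_of_int a)
         - (real_of_int e * (12 / real_of_int a)) * (ln (real y) - 1)" by (simp only: a *)
    qed
    also have "\<dots> = cheb_sum y / real y - cheb_const
        - (\<Sum>(a, e)\<leftarrow>cheb_coeffs. real_of_int e * (12 / real_of_int a)) * (ln (real y) - 1)"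
      by (simp add: cheb_sum_def cheb_const_def case_prod_unfold sum_list_subtractf sum_list_mult_const
           divide_inverse)
    also have "(\<Sum>(a, e)\<leftarrow>cheb_coeffs. real_of_int e * (12 / real_of_int a)) = 0"
      by (simp add: cheb_coeffs_def)
    finally show ?thesis by simp
  qed
  moreover have "(\<lambda>y. \<Sum>(a, e)\<leftarrow>cheb_coeffs. real_of_int e * ?D a y) \<longlonglongrightarrow> 0"
    unfolding case_prod_unfold
  proof (rule tendsto_sum_list_null, rule tendsto_mult_right_zero)
    fix x assume "x \<in> set cheb_coeffs"
    hence "nat (fst x) > 0" using pos by auto
    thus "?D (fst x) \<longlonglongrightarrow> 0" by (rule ln_fact_div_asymp)
  qed
  ultimately have "(\<lambda>y. cheb_sum y / real y - cheb_const) \<longlonglongrightarrow> 0" by simp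
  thus ?thesis by (simp add: LIM_zero_iff)
qed

text \<open>The number 0.213 is \<open>1 - 0.787\<close>. All logarithms are reduced to those of 2,
  3/2, 5/4 and 7/6, for which short series are accurate enough.\<close>

lemma cheb_const_gt: "cheb_const > 48 * 0.213"
proof -
  define A where "A = ln (2 :: real)"
  define B where "B = ln (3 / 2 :: real)"
  define C where "C = ln (5 / 4 :: real)"
  define D where "D = ln (7 / 6 :: real)"
  have l3: "ln (3::real) = A + B" using ln_mult[of 2 "3/2 :: real"] by (simp add: A_def B_def)
  have l4: "ln (4::real) = 2 * A" using ln_mult[of 2 "2 :: real"] by (simp add: A_def)
  have l5: "ln (5::real) = 2 * A + C" using ln_mult[of 4 "5/4 :: real"] l4 by (simp add: C_def)
  have l6: "ln (6::real) = 2 * A + B" using ln_mult[of 2 "3 :: real"] l3 by (simp add: A_def)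
  have l7: "ln (7::real) = 2 * A + B + D" using ln_mult[of 6 "7/6 :: real"] l6 by (simp add: D_def)
  have l10: "ln (10::real) = 3 * A + C" using ln_mult[of 2 "5 :: real"] l5 by (simp add: A_def)
  have l12: "ln (12::real) = 3 * A + B" using ln_mult[of 3 "4 :: real"] l3 l4 by simp
  have l15: "ln (15::real) = 3 * A + B + C" using ln_mult[of 3 "5 :: real"] l3 l5 by simp
  have l21: "ln (21::real) = 3 * A + 2 * B + D" using ln_mult[of 3 "7 :: real"] l3 l7 by simp
  have l35: "ln (35::real) = 4 * A + B + C + D" using ln_mult[of 5 "7 :: real"] l5 l7 by simp
  have l210: "ln (210::real) = 6 * A + 2 * B + C + D" using ln_mult[of 6 "35 :: real"] l6 l35 by simp
  \<comment> \<open>The signs decide which numerical bounds are needed: lower ones for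
    \<open>A\<close> and \<open>B\<close>, upper ones for \<open>C\<close> and
    \<open>D\<close>.\<close>
  have "cheb_const / 48 \<ge> 31/80 * A + 31/480 * B - 395/2016 * C - 39/160 * D"
    unfolding cheb_const_def cheb_coeffs_def
    by (simp, simp add: ln_div l3 l4 l5 l6 l7 l10 l12 l15 l21 l35 l210 flip: A_def,
        simp only: add_divide_distrib diff_divide_distrib minus_divide_left[symmetric] minus_add_distrib)
  moreover have "A \<ge> 0.69313" "B \<ge> 0.40546" "C \<le> 0.22315" "D \<le> 0.15416"
    using ln_approx_bounds[of 2 4] ln_approx_bounds[of "3/2" 3] ln_approx_bounds[of "5/4" 2]
      ln_approx_bounds[of "7/6" 2]
    by (simp_all add: A_def B_def C_def D_def eval_nat_numeral)
  ultimately show ?thesis by simp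
qed

text \<open>What matters is that 0.787 is smaller than half of 1 plus Euler's constant.\<close>

lemma mertens_ge: "\<forall>\<^sub>F y in sequentially. mertens y \<ge> ln (real y) - 0.787"
proof -
  have "\<forall>\<^sub>F y in sequentially. cheb_sum y / real y > 48 * 0.213"
    using cheb_sum_asymp cheb_const_gt by (rule order_tendstoD)
  thus ?thesis using eventually_ge_at_top[of 1]
  proof eventually_elim
    case (elim y)
    have "48 * 0.213 * real y < cheb_sum y" using elim by (simp add: field_simps)
    also have "\<dots> \<le> 48 * (real y * mertens y - ln (fact y))" by (rule cheb_sum_le)
    also have "\<dots> \<le> 48 * (real y * mertens y - (real y * ln (real y) - real y))"
      using ln_fact_bounds[of y] elim by simp
    finally have "real y * (ln (real y) - 0.787) \<le> real y * mertens y" by (simp add: algebra_simps)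
    thus ?case using elim by simp
  qed
qed

subsection \<open>Second-order expansion of the reciprocal logarithm\<close>

text \<open>Closed form of the integral of \<open>2 / w^3 * max 0 (w - v)\<close> over
  \<open>w\<close> from \<open>a\<close> to \<open>L\<close>: Taylor's integral remainder for
  \<open>1 / v\<close> at \<open>L\<close>, truncated at \<open>a\<close>.\<close>

definition kernel_int :: "real \<Rightarrow> real \<Rightarrow> real \<Rightarrow> real" where
  "kernel_int a L v = (if v < a then 2 / a - v / a\<^sup>2 else 1 / v) - 2 / L + v / L\<^sup>2"

text \<open>A primitive of the integrand for \<open>w \<ge> v\<close> is
  \<open>- 2 / w + v / w^2\<close>; below \<open>v\<close> the integrand vanishes, so the
  integration effectively starts at the larger of \<open>a\<close> and \<open>v\<close>.\<close>

lemma kernel_has_integral: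
  assumes "0 < a" "a \<le> L" "v \<le> L"
  shows "((\<lambda>w. 2 / w ^ 3 * max 0 (w - v)) has_integral kernel_int a L v) {a..L}"
proof -
  define F where "F = (\<lambda>w::real. - 2 / w + v / w\<^sup>2)"
  have FTC: "((\<lambda>w. 2 / w ^ 3 * max 0 (w - v)) has_integral F L - F s) {s..L}"
    if s: "0 < s" "v \<le> s" "s \<le> L" for s
  proof -
    have "((\<lambda>w. 2 / w ^ 3 * (w - v)) has_integral F L - F s) {s..L}"
    proof (rule fundamental_theorem_of_calculus)
      fix w assume w: "w \<in> {s..L}"
      hence "w > 0" using s by auto
      hence "(F has_field_derivative 2 / w ^ 3 * (w - v)) (at w within {s..L})"
        unfolding F_def
        by (auto intro!: derivative_eq_intros simp: field_simps power2_eq_square power3_eq_cube)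
      thus "(F has_vector_derivative 2 / w ^ 3 * (w - v)) (at w within {s..L})"
        by (simp add: has_real_derivative_iff_has_vector_derivative)
    qed (use s in auto)
    thus ?thesis using s by (rule_tac has_integral_eq[rotated]) (auto simp: max_def)
  qed
  show ?thesis
  proof (cases "v < a")
    case True
    have "F L - F a = kernel_int a L v" using True by (simp add: F_def kernel_int_def)
    thus ?thesis using FTC[of a] True assms by simp
  next
    case False
    have "((\<lambda>w. 2 / w ^ 3 * max 0 (w - v)) has_integral 0) {a..v}"
      by (rule has_integral_is_0) auto
    moreover have "((\<lambda>w. 2 / w ^ 3 * max 0 (w - v)) has_integral F L - F v) {v..L}"
      using FTC[of v] False assms by simp
    ultimately have "((\<lambda>w. 2 / w ^ 3 * max 0 (w - v)) has_integral 0 + (F L - F v)) {a..L}"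
      using False assms by (intro has_integral_combine[of a v L]) auto
    moreover have "0 + (F L - F v) = kernel_int a L v"
      using False assms by (simp add: F_def kernel_int_def power2_eq_square field_simps)
    ultimately show ?thesis by simp
  qed
qed

lemma kernel_bound_has_integral:
  fixes a L g c :: real
  assumes "0 < a" "a \<le> L"
  shows "((\<lambda>w. 2 / w ^ 3 * (w\<^sup>2 / 2 - g * w + c)) has_integral
    (ln L - ln a + 2 * g * (1 / L - 1 / a) - c * (1 / L\<^sup>2 - 1 / a\<^sup>2))) {a..L}"
proof -
  define F where "F = (\<lambda>w::real. ln w + 2 * g / w - c / w\<^sup>2)"
  have "((\<lambda>w. 2 / w ^ 3 * (w\<^sup>2 / 2 - g * w + c)) has_integral F L - F a) {a..L}"
  proof (rule fundamental_theorem_of_calculus)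
    fix w assume w: "w \<in> {a..L}"
    hence "w > 0" using assms by auto
    hence "(F has_field_derivative 2 / w ^ 3 * (w\<^sup>2 / 2 - g * w + c)) (at w within {a..L})"
      unfolding F_def
      by (auto intro!: derivative_eq_intros simp: field_simps power2_eq_square power3_eq_cube)
    thus "(F has_vector_derivative 2 / w ^ 3 * (w\<^sup>2 / 2 - g * w + c)) (at w within {a..L})"
      by (simp add: has_real_derivative_iff_has_vector_derivative)
  qed (use assms in auto)
  moreover have "F L - F a = ln L - ln a + 2 * g * (1 / L - 1 / a) - c * (1 / L\<^sup>2 - 1 / a\<^sup>2)"
    by (simp add: F_def algebra_simps)
  ultimately show ?thesis by simp
qed

lemma sum_mangoldt_max_eq_log_mertens:
  assumes "0 \<le> w" "exp w \<le> real X"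
  shows "(\<Sum>d=1..X. \<Lambda> d / real d * max 0 (w - ln (real d))) = log_mertens (exp w)"
proof -
  define n where "n = nat \<lfloor>exp w\<rfloor>"
  have n: "real n \<le> exp w" "exp w < real n + 1" using exp_gt_zero[of w] unfolding n_def by linarith+
  have nX: "n \<le> X" using n assms by linarith
  have "log_mertens (exp w) = (\<Sum>d=1..n. \<Lambda> d / real d * max 0 (w - ln (real d)))"
    unfolding log_mertens_def n_def[symmetric]
  proof (intro sum.cong refl)
    fix d assume d: "d \<in> {1..n}"
    hence "real d \<le> exp w" using n by auto
    hence "exp (ln (real d)) \<le> exp w" using d by simp
    hence "ln (real d) \<le> w" by simp
    moreover have "ln (exp w / real d) = w - ln (real d)" using d by (simp add: ln_div)
    ultimately show "\<Lambda> d / real d * ln (exp w / real d) = \<Lambda> d / real d * max 0 (w - ln (real d))"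
      by simp
  qed
  also have "\<dots> = (\<Sum>d=1..X. \<Lambda> d / real d * max 0 (w - ln (real d)))"
  proof (intro sum.mono_neutral_left ballI)
    fix d assume d: "d \<in> {1..X} - {1..n}"
    hence "exp w \<le> real d" using n by auto
    hence "ln (exp w) \<le> ln (real d)" by (intro ln_mono) auto
    thus "\<Lambda> d / real d * max 0 (w - ln (real d)) = 0" by simp
  qed (use nX in auto)
  finally show ?thesis ..
qed

lemma log_mertens_bounds':
  assumes "x \<ge> 1"
  shows "log_mertens x \<le> (ln x)\<^sup>2 / 2 - euler_mascheroni * ln x + 17"
    and "log_mertens x \<ge> (ln x)\<^sup>2 / 2 - euler_mascheroni * ln x - 17"
  using log_mertens_bounds[OF assms] by (auto simp: abs_le_iff)

text \<open>The kernel is a nonnegative superposition of the functions \<open>max 0 (w - v)\<close>.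
  After exchanging sum and integral, each \<open>w\<close> contributes at most
  \<open>log_mertens (exp w)\<close> up to the factor \<open>2 * X / w^3\<close>, and the bound for
  it is integrated.\<close>

lemma sum_kernel_int_le:
  assumes "X \<ge> 2" and L: "L = ln (real X)" and a: "0 < a" "a \<le> L"
  shows "(\<Sum>d=1..X. \<Lambda> d * real (X div d) * kernel_int a L (ln (real d))) \<le>
    real X * (ln L - ln a + 2 * euler_mascheroni * (1 / L - 1 / a) - 17 * (1 / L\<^sup>2 - 1 / a\<^sup>2))"
proof (rule has_integral_le)
  show "((\<lambda>w. \<Sum>d=1..X. \<Lambda> d * real (X div d) * (2 / w ^ 3 * max 0 (w - ln (real d)))) has_integral
      (\<Sum>d=1..X. \<Lambda> d * real (X div d) * kernel_int a L (ln (real d)))) {a..L}"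
    using a by (intro has_integral_sum has_integral_mult_right kernel_has_integral) (auto simp: L)
  show "((\<lambda>w. real X * (2 / w ^ 3 * (w\<^sup>2 / 2 - euler_mascheroni * w + 17))) has_integral
      real X * (ln L - ln a + 2 * euler_mascheroni * (1 / L - 1 / a) - 17 * (1 / L\<^sup>2 - 1 / a\<^sup>2))) {a..L}"
    using a by (intro has_integral_mult_right kernel_bound_has_integral) auto
  fix w assume w: "w \<in> {a..L}"
  hence w0: "w > 0" using a by auto
  have "exp w \<le> exp (ln (real X))" using w L by auto
  hence wX: "exp w \<le> real X" using assms by simp
  have "(\<Sum>d=1..X. \<Lambda> d * real (X div d) * (2 / w ^ 3 * max 0 (w - ln (real d))))
     \<le> (\<Sum>d=1..X. \<Lambda> d * (real X / real d) * (2 / w ^ 3 * max 0 (w - ln (real d))))"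
    using w0 by (intro sum_mono mult_right_mono mult_left_mono of_nat_div_le_of_nat) (auto simp: mangoldt_nonneg)
  also have "\<dots> = real X * (2 / w ^ 3 * (\<Sum>d=1..X. \<Lambda> d / real d * max 0 (w - ln (real d))))"
    unfolding sum_distrib_left by (intro sum.cong refl) (simp add: algebra_simps)
  also have "(\<Sum>d=1..X. \<Lambda> d / real d * max 0 (w - ln (real d))) = log_mertens (exp w)"
    using w0 wX by (intro sum_mangoldt_max_eq_log_mertens) auto
  also have "real X * (2 / w ^ 3 * log_mertens (exp w)) \<le> real X * (2 / w ^ 3 * (w\<^sup>2 / 2 - euler_mascheroni * w + 17))"
    using w0 log_mertens_bounds'(1)[of "exp w"] by (intro mult_left_mono) auto
  finally show "(\<Sum>d=1..X. \<Lambda> d * real (X div d) * (2 / w ^ 3 * max 0 (w - ln (real d))))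
    \<le> real X * (2 / w ^ 3 * (w\<^sup>2 / 2 - euler_mascheroni * w + 17))" .
qed

lemma sum_mangoldt_ln_le:
  assumes "X \<ge> 1"
  shows "(\<Sum>d=1..X. \<Lambda> d * real (X div d) * (ln (real X) - ln (real d))) \<le>
    real X * ((ln (real X))\<^sup>2 / 2 - euler_mascheroni * ln (real X) + 17)"
proof -
  have "(\<Sum>d=1..X. \<Lambda> d * real (X div d) * (ln (real X) - ln (real d)))
     \<le> (\<Sum>d=1..X. \<Lambda> d * (real X / real d) * (ln (real X) - ln (real d)))"
    using assms by (intro sum_mono mult_right_mono mult_left_mono of_nat_div_le_of_nat) (auto simp: mangoldt_nonneg)
  also have "\<dots> = real X * log_mertens (real X)"
    unfolding log_mertens_def sum_distrib_left by (intro sum.cong) (use assms in \<open>auto simp: ln_div mult_ac\<close>)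
  also have "\<dots> \<le> real X * ((ln (real X))\<^sup>2 / 2 - euler_mascheroni * ln (real X) + 17)"
    using assms log_mertens_bounds'(1)[of "real X"] by (intro mult_left_mono) auto
  finally show ?thesis .
qed

text \<open>Second-order Taylor expansion of \<open>1 / v\<close> at \<open>L\<close>, with the remainder cut off at \<open>a\<close>:
  below \<open>a\<close> it leaves the tangent of \<open>1 / v\<close> at \<open>a\<close>.\<close>

lemma kernel_expansion:
  assumes "0 < a" "0 < L"
  shows "(if v < a then 0 else 1 / v) =
    1 / L + (L - v) / L\<^sup>2 + kernel_int a L v - (if v < a then 1 / a + (a - v) / a\<^sup>2 else 0)"
  using assms by (simp add: kernel_int_def power2_eq_square diff_divide_distrib)

text \<open>A lower bound is needed because this sum is subtracted. Here \<open>y\<close> is the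
  largest integer with \<open>y * y < X\<close>, so \<open>ln y\<close> is within
  \<open>1 / y\<close> of \<open>a\<close>; 19 covers 17 plus the 3/2 lost in the square. The weight
  of \<open>d\<close> lies between 0 and \<open>2 / a\<close>, so rounding \<open>X / d\<close> down
  costs at most \<open>8 * y / a\<close> in total.\<close>

lemma sum_small_ge:
  assumes y: "y \<ge> 1" "y * y < X" "X \<le> (y + 1) * (y + 1)" and a: "a = ln (real X) / 2"
  shows "(\<Sum>d=1..y. \<Lambda> d * real (X div d) * (1 / a + (a - ln (real d)) / a\<^sup>2)) \<ge>
    real X * (mertens y / a + (a\<^sup>2 / 2 - euler_mascheroni * a - 19) / a\<^sup>2) - 8 * real y / a"
proof -
  define b where "b = ln (real y)"
  have X: "X \<ge> 2" using y by (cases X rule: nat.exhaust) (auto simp: Suc_le_eq intro: ccontr)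
  have a0: "a > 0" using X by (simp add: a)
  have "real (y * y) \<le> real X" using y by linarith
  hence "ln (real y * real y) \<le> ln (real X)" using y by (intro ln_mono) auto
  hence ba: "b \<le> a" using y by (simp add: a b_def ln_mult)
  have "real X \<le> real ((y + 1) * (y + 1))" using y by linarith
  hence "ln (real X) \<le> ln (real (Suc y) * real (Suc y))"
    using X by (intro ln_mono) (auto simp: algebra_simps)
  hence "a \<le> ln (real (Suc y))" by (simp add: a ln_mult del: of_nat_Suc)
  also have "\<dots> \<le> b + 1 / real y" using ln_Suc_diff[of y] y by (simp add: b_def)
  finally have ab: "a \<le> b + 1 / real y" .
  have b0: "b \<ge> 0" "b \<le> real y" using y ln_le_minus_one[of "real y"] by (auto simp: b_def)
  have y1: "1 / real y \<le> 1" using y by simp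
  have "a\<^sup>2 - b\<^sup>2 = (a - b) * (a + b)" by (simp add: power2_eq_square algebra_simps)
  also have "\<dots> \<le> 1 / real y * (3 * real y)"
  proof (intro mult_mono)
    have "real y \<ge> 1" using y by simp
    thus "a + b \<le> 3 * real y" using ab b0 y1 by linarith
  qed (use ab ba b0 in auto)
  also have "\<dots> = 3" using y by simp
  finally have sq: "a\<^sup>2 - b\<^sup>2 \<le> 3" .
  have vb: "ln (real d) \<le> b" if "d \<in> {1..y}" for d using that by (auto simp: b_def)
  have "a\<^sup>2 / 2 - euler_mascheroni * a - 19 \<le> b\<^sup>2 / 2 - euler_mascheroni * b - 17"
  proof -
    have "euler_mascheroni * b \<le> euler_mascheroni * a"
      using ba euler_mascheroni_pos by (intro mult_left_mono) auto
    thus ?thesis using sq by linarith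
  qed
  also have "\<dots> \<le> log_mertens (real y)" using log_mertens_bounds'(2)[of "real y"] y by (simp add: b_def)
  also have "\<dots> = (\<Sum>d=1..y. \<Lambda> d / real d * (b - ln (real d)))"
    unfolding log_mertens_def b_def by (intro sum.cong) (use y in \<open>auto simp: ln_div\<close>)
  also have "\<dots> \<le> (\<Sum>d=1..y. \<Lambda> d / real d * (a - ln (real d)))"
    using ba by (intro sum_mono mult_left_mono) (auto simp: mangoldt_nonneg)
  finally have Ja: "a\<^sup>2 / 2 - euler_mascheroni * a - 19 \<le> (\<Sum>d=1..y. \<Lambda> d / real d * (a - ln (real d)))" .
  have "real X * (mertens y / a + (a\<^sup>2 / 2 - euler_mascheroni * a - 19) / a\<^sup>2) - 8 * real y / a
    \<le> real X * (mertens y / a + (\<Sum>d=1..y. \<Lambda> d / real d * (a - ln (real d))) / a\<^sup>2) - 2 / a * (\<Sum>d=1..y. \<Lambda> d)"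
    using Ja a0 mult_left_mono[OF sum_mangoldt_le[of y], of "2 / a"]
    by (intro diff_mono mult_left_mono add_left_mono divide_right_mono) auto
  also have "\<dots> = (\<Sum>d=1..y. \<Lambda> d * (real X / real d * (1 / a + (a - ln (real d)) / a\<^sup>2) - 2 / a))"
    by (simp add: mertens_def sum_distrib_left sum_divide_distrib sum_subtractf sum.distrib algebra_simps)
  also have "\<dots> \<le> (\<Sum>d=1..y. \<Lambda> d * (real (X div d) * (1 / a + (a - ln (real d)) / a\<^sup>2)))"
  proof (intro sum_mono mult_left_mono)
    fix d assume d: "d \<in> {1..y}"
    define t where "t = 1 / a + (a - ln (real d)) / a\<^sup>2"
    have "(a - ln (real d)) / a\<^sup>2 \<ge> 0" using vb[OF d] ba by (intro divide_nonneg_nonneg) auto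
    hence t0: "t \<ge> 0" using a0 by (simp add: t_def)
    have "(a - ln (real d)) / a\<^sup>2 \<le> a / a\<^sup>2" using d by (intro divide_right_mono) auto
    also have "a / a\<^sup>2 = 1 / a" by (simp add: power2_eq_square)
    finally have t2: "t \<le> 2 / a" by (simp add: t_def)
    have "real (X mod d) / real d \<le> 1" using d by simp
    hence "real X / real d - real (X div d) \<le> 1" by (simp add: of_nat_of_nat_div_aux[of X d])
    hence "(real X / real d - real (X div d)) * t \<le> 1 * t" using t0 by (rule mult_right_mono)
    hence "real X / real d * t - real (X div d) * t \<le> t" by (simp add: left_diff_distrib)
    thus "real X / real d * (1 / a + (a - ln (real d)) / a\<^sup>2) - 2 / a
        \<le> real (X div d) * (1 / a + (a - ln (real d)) / a\<^sup>2)"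
      using t2 unfolding t_def[symmetric] by linarith
  qed (auto simp: mangoldt_nonneg)
  finally show ?thesis by (simp only: mult.assoc)
qed

subsection \<open>Numbers with a large prime divisor\<close>

text \<open>The cutoff \<open>ln d < a\<close> is the same as \<open>d * d < X\<close>, that is
  \<open>d \<le> y\<close>, so the expansion of \<open>1 / v\<close> can be summed with
  \<open>v = ln d\<close> for all \<open>d \<le> X\<close>.\<close>

lemma sum_large_eq:
  assumes y: "y * y < X" "X \<le> (y + 1) * (y + 1)" and X: "X \<ge> 2"
    and L: "L = ln (real X)" and a: "a = L / 2"
  shows "(\<Sum>d\<in>{d\<in>{1..X}. X \<le> d * d}. \<Lambda> d * real (X div d) / ln (real d)) =
    (\<Sum>d=1..X. \<Lambda> d * real (X div d)) / L
    + (\<Sum>d=1..X. \<Lambda> d * real (X div d) * (L - ln (real d))) / L\<^sup>2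
    + (\<Sum>d=1..X. \<Lambda> d * real (X div d) * kernel_int a L (ln (real d)))
    - (\<Sum>d=1..y. \<Lambda> d * real (X div d) * (1 / a + (a - ln (real d)) / a\<^sup>2))"
proof -
  have pos: "0 < L" "0 < a" using X by (auto simp: a L)
  have iff: "ln (real d) < a \<longleftrightarrow> d * d < X" if "d \<in> {1..X}" for d
  proof -
    have "ln (real d) < a \<longleftrightarrow> ln (real d * real d) < ln (real X)"
      using that by (auto simp: a L ln_mult)
    also have "\<dots> \<longleftrightarrow> real d * real d < real X" using that X by (intro ln_less_cancel_iff) auto
    also have "\<dots> \<longleftrightarrow> d * d < X" by (simp flip: of_nat_mult)
    finally show ?thesis .
  qed
  have small: "{d\<in>{1..X}. d * d < X} = {1..y}"
  proof (intro set_eqI iffI)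
    fix d assume "d \<in> {d\<in>{1..X}. d * d < X}"
    hence d: "d \<ge> 1" "d * d < X" by auto
    have "d \<le> y"
    proof (rule ccontr)
      assume "\<not> d \<le> y"
      hence "(y + 1) * (y + 1) \<le> d * d" by (intro mult_le_mono) auto
      thus False using d y by linarith
    qed
    thus "d \<in> {1..y}" using d by auto
  next
    fix d assume d: "d \<in> {1..y}"
    hence "d * d \<le> y * y" by (intro mult_le_mono) auto
    moreover have "d \<le> d * d" by simp
    ultimately have "d \<le> X" "d * d < X" using y by linarith+
    thus "d \<in> {d\<in>{1..X}. d * d < X}" using d y by auto
  qed
  let ?B = "\<lambda>d. \<Lambda> d * real (X div d)"
  have "(\<Sum>d\<in>{d\<in>{1..X}. X \<le> d * d}. ?B d / ln (real d)) =
      (\<Sum>d=1..X. ?B d * (if ln (real d) < a then 0 else 1 / ln (real d)))"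
    using iff by (intro sum.mono_neutral_cong_left) (auto simp: not_less)
  also have "\<dots> = (\<Sum>d=1..X. ?B d / L + ?B d * (L - ln (real d)) / L\<^sup>2 + ?B d * kernel_int a L (ln (real d))
      - ?B d * (if ln (real d) < a then 1 / a + (a - ln (real d)) / a\<^sup>2 else 0))"
    unfolding kernel_expansion[OF pos(2,1)] by (intro sum.cong refl) (simp only: ring_distribs times_divide_eq_right mult_1_right)
  also have "\<dots> = (\<Sum>d=1..X. ?B d) / L + (\<Sum>d=1..X. ?B d * (L - ln (real d))) / L\<^sup>2
    + (\<Sum>d=1..X. ?B d * kernel_int a L (ln (real d)))
    - (\<Sum>d=1..X. ?B d * (if ln (real d) < a then 1 / a + (a - ln (real d)) / a\<^sup>2 else 0))"
    by (simp only: sum.distrib sum_subtractf sum_divide_distrib)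
  also have "(\<Sum>d=1..X. ?B d * (if ln (real d) < a then 1 / a + (a - ln (real d)) / a\<^sup>2 else 0))
     = (\<Sum>d=1..y. ?B d * (1 / a + (a - ln (real d)) / a\<^sup>2))"
    unfolding small[symmetric] using iff by (intro sum.mono_neutral_cong_right) auto
  finally show ?thesis .
qed

text \<open>The constant terms 1, 1/2, \<open>ln 2\<close> and -3/2 leave \<open>ln 2\<close>, and
  the terms in \<open>1 / L\<close> leave \<open>0.575 - \<gamma>\<close>, which is negative. The
  coefficient 144 is 17 + 51 + 76.\<close>

lemma sum_large_le:
  assumes y: "y \<ge> 2000" "y * y < X" "X \<le> (y + 1) * (y + 1)" and My: "mertens y \<ge> ln (real y) - 0.787"
    and L: "L = ln (real X)"
  shows "(\<Sum>d\<in>{d\<in>{1..X}. X \<le> d * d}. \<Lambda> d * real (X div d) / ln (real d)) \<le>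
    real X * (ln 2 - 0.0007 / L + 144 / L\<^sup>2) + 2 + 16 * sqrt (real X) / L"
proof -
  define a where "a = L / 2"
  define g :: real where "g = euler_mascheroni"
  have "2000 * 2000 \<le> y * y" using y by (intro mult_le_mono) auto
  hence X: "X \<ge> 4000000" using y by linarith
  hence "X \<ge> 2" by simp
  have "exp 1 \<le> real X" using exp_le X by linarith
  hence L1: "L \<ge> 1" unfolding L using X by (subst ln_ge_iff) auto
  have a0: "a > 0" using L1 by (simp add: a_def)
  have S1: "(\<Sum>d=1..X. \<Lambda> d * real (X div d)) / L \<le> real X * (1 - 1 / L) + 2"
  proof -
    have "(\<Sum>d=1..X. \<Lambda> d * real (X div d)) \<le> real X * L - real X + L + 1"
      using ln_fact_bounds(2)[of X] X by (simp add: ln_fact_eq_sum_mangoldt[of X X] L)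
    hence "(\<Sum>d=1..X. \<Lambda> d * real (X div d)) / L \<le> (real X * L - real X + L + 1) / L"
      using L1 by (intro divide_right_mono) auto
    also have "\<dots> = real X * (1 - 1 / L) + 1 + 1 / L" using L1 by (simp add: field_simps)
    finally have "(\<Sum>d=1..X. \<Lambda> d * real (X div d)) / L \<le> real X * (1 - 1 / L) + 1 + 1 / L" .
    moreover have "1 / L \<le> 1" using L1 by simp
    ultimately show ?thesis by linarith
  qed
  have S2: "(\<Sum>d=1..X. \<Lambda> d * real (X div d) * (L - ln (real d))) / L\<^sup>2 \<le> real X * (1/2 - g / L + 17 / L\<^sup>2)"
  proof -
    have "(\<Sum>d=1..X. \<Lambda> d * real (X div d) * (L - ln (real d))) / L\<^sup>2 \<le> real X * (L\<^sup>2 / 2 - g * L + 17) / L\<^sup>2"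
      using sum_mangoldt_ln_le[of X] X unfolding L g_def by (intro divide_right_mono) auto
    also have "\<dots> = real X * (1/2 - g / L + 17 / L\<^sup>2)"
      using L1 by (simp add: field_simps power2_eq_square)
    finally show ?thesis .
  qed
  have S3: "(\<Sum>d=1..X. \<Lambda> d * real (X div d) * kernel_int a L (ln (real d))) \<le>
      real X * (ln 2 - 2 * g / L + 51 / L\<^sup>2)"
  proof -
    have "(\<Sum>d=1..X. \<Lambda> d * real (X div d) * kernel_int a L (ln (real d))) \<le>
      real X * (ln L - ln a + 2 * g * (1 / L - 1 / a) - 17 * (1 / L\<^sup>2 - 1 / a\<^sup>2))"
      unfolding g_def using X L L1 a0 by (intro sum_kernel_int_le) (auto simp: a_def)
    \<comment> \<open>The choice \<open>a = L / 2\<close> produces \<open>ln 2\<close> and the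
      factor 3 in 51 = 3 * 17.\<close>
    also have "ln L - ln a + 2 * g * (1 / L - 1 / a) - 17 * (1 / L\<^sup>2 - 1 / a\<^sup>2) = ln 2 - 2 * g / L + 51 / L\<^sup>2"
      using L1 by (simp add: a_def ln_div field_simps power2_eq_square)
    finally show ?thesis .
  qed
  have S4: "(\<Sum>d=1..y. \<Lambda> d * real (X div d) * (1 / a + (a - ln (real d)) / a\<^sup>2)) \<ge>
      real X * (3/2 - 1.575 / L - 2 * g / L - 76 / L\<^sup>2) - 16 * sqrt (real X) / L"
  proof -
    have "real X \<le> real (Suc y * Suc y)" using y by (simp only: of_nat_le_iff) simp
    hence "ln (real X) \<le> ln (real (Suc y) * real (Suc y))"
      using X by (intro ln_mono) (auto simp: algebra_simps)
    hence "a \<le> ln (real (Suc y))" by (simp add: a_def L ln_mult del: of_nat_Suc)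
    also have "\<dots> \<le> ln (real y) + 1 / real y" using ln_Suc_diff[of y] y by simp
    \<comment> \<open>This is where \<open>y \<ge> 2000\<close> enters: 0.7875 = 0.787 + 1/2000, and
      1.575 is its double.\<close>
    also have "1 / real y \<le> 1 / 2000" using y by (intro divide_left_mono) auto
    finally have "a - 0.7875 \<le> mertens y" using My by simp
    hence "(a - 0.7875) / a \<le> mertens y / a" using a0 by (intro divide_right_mono) auto
    moreover have "(a - 0.7875) / a = 1 - 1.575 / L" using L1 by (simp add: a_def field_simps)
    moreover have "(a\<^sup>2 / 2 - g * a - 19) / a\<^sup>2 = 1/2 - 2 * g / L - 76 / L\<^sup>2"
      using L1 by (simp add: a_def field_simps power2_eq_square)
    ultimately have "3/2 - 1.575 / L - 2 * g / L - 76 / L\<^sup>2 \<le> mertens y / a + (a\<^sup>2 / 2 - g * a - 19) / a\<^sup>2"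
      by linarith
    hence "real X * (3/2 - 1.575 / L - 2 * g / L - 76 / L\<^sup>2) \<le> real X * (mertens y / a + (a\<^sup>2 / 2 - g * a - 19) / a\<^sup>2)"
      by (intro mult_left_mono) auto
    moreover have "8 * real y / a \<le> 16 * sqrt (real X) / L"
    proof -
      have "real (y * y) \<le> real X" using y by linarith
      hence "real y \<le> sqrt (real X)" by (intro real_le_rsqrt) (simp add: power2_eq_square)
      thus ?thesis using L1 by (simp add: a_def divide_right_mono)
    qed
    moreover have "real X * (mertens y / a + (a\<^sup>2 / 2 - g * a - 19) / a\<^sup>2) - 8 * real y / a \<le>
       (\<Sum>d=1..y. \<Lambda> d * real (X div d) * (1 / a + (a - ln (real d)) / a\<^sup>2))"
      unfolding g_def using y by (intro sum_small_ge) (auto simp: a_def L)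
    ultimately show ?thesis by linarith
  qed
  have "(\<Sum>d\<in>{d\<in>{1..X}. X \<le> d * d}. \<Lambda> d * real (X div d) / ln (real d)) \<le>
     (real X * (1 - 1 / L) + 2) + real X * (1/2 - g / L + 17 / L\<^sup>2) + real X * (ln 2 - 2 * g / L + 51 / L\<^sup>2)
     - (real X * (3/2 - 1.575 / L - 2 * g / L - 76 / L\<^sup>2) - 16 * sqrt (real X) / L)"
    unfolding sum_large_eq[OF y(2,3) \<open>X \<ge> 2\<close> L a_def] by (intro diff_mono add_mono S1 S2 S3 S4)
  also have "\<dots> = real X * (ln 2 - (g - 0.575) / L + 144 / L\<^sup>2) + 2 + 16 * sqrt (real X) / L"
    using L1 by (simp add: algebra_simps diff_divide_distrib)
  also have "\<dots> \<le> real X * (ln 2 - 0.0007 / L + 144 / L\<^sup>2) + 2 + 16 * sqrt (real X) / L"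
  proof -
    \<comment> \<open>Euler's constant exceeds 19/33, which is greater than 0.5757.\<close>
    have "0.0007 / L \<le> (g - 0.575) / L"
      using euler_mascheroni_gt_19_over_33 L1 by (intro divide_right_mono) (auto simp: g_def)
    thus ?thesis by (intro add_right_mono mult_left_mono) auto
  qed
  finally show ?thesis .
qed

text \<open>The gain \<open>0.0007 * X / L\<close> eventually outweighs all the error terms, which
  are of smaller order. The spare 1 pays for rounding \<open>N\<close> down.\<close>

lemma sum_large_eventually_le:
  "\<forall>\<^sub>F X in sequentially.
    (\<Sum>d\<in>{d\<in>{1..X}. X \<le> d * d}. \<Lambda> d * real (X div d) / ln (real d)) \<le> real X * ln 2 - 1"
proof -
  obtain Y where Y: "\<And>y. y \<ge> Y \<Longrightarrow> mertens y \<ge> ln (real y) - 0.787"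
    using mertens_ge unfolding eventually_sequentially by blast
  define Z where "Z = max Y 2000"
  have "\<forall>\<^sub>F X in sequentially. real X * (ln 2 - 0.0007 / ln (real X) + 144 / (ln (real X))\<^sup>2) + 2
      + 16 * sqrt (real X) / ln (real X) \<le> real X * ln 2 - 1"
    by real_asymp
  thus ?thesis using eventually_gt_at_top[of "Z * Z"]
  proof eventually_elim
    case (elim X)
    \<comment> \<open>Taking \<open>X - 1\<close> makes \<open>y * y < X\<close> strict also when
      \<open>X\<close> is a perfect square.\<close>
    define y where "y = floor_sqrt (X - 1)"
    have "Z * Z \<le> X - 1" "X \<ge> 1" using elim by auto
    hence "Z \<le> y" by (simp add: y_def le_floor_sqrtI power2_eq_square)
    moreover have "y * y \<le> X - 1" using floor_sqrt_power2_le[of "X - 1"] by (simp add: y_def power2_eq_square)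
    moreover have "X - 1 < (y + 1) * (y + 1)"
      using Suc_floor_sqrt_power2_gt[of "X - 1"] by (simp add: y_def power2_eq_square)
    ultimately have "(\<Sum>d\<in>{d\<in>{1..X}. X \<le> d * d}. \<Lambda> d * real (X div d) / ln (real d)) \<le>
       real X * (ln 2 - 0.0007 / ln (real X) + 144 / (ln (real X))\<^sup>2) + 2 + 16 * sqrt (real X) / ln (real X)"
      using Y[of y] \<open>X \<ge> 1\<close> by (intro sum_large_le[of y]) (auto simp: Z_def)
    thus ?case using elim by linarith
  qed
qed

text \<open>An integer up to \<open>X\<close> outside \<open>E N\<close> is a multiple of a prime
  \<open>p\<close> with \<open>p * p \<ge> N \<ge> X\<close>, and each such \<open>p\<close> has
  \<open>X div p\<close> multiples. For primes \<open>\<Lambda> p / ln p\<close> is 1; the other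
  prime powers only enlarge the sum.\<close>

lemma card_E_ge:
  assumes "N > 1"
  defines "X \<equiv> nat \<lfloor>N\<rfloor>"
  shows "real (card (E N)) \<ge> real X - (\<Sum>d\<in>{d\<in>{1..X}. X \<le> d * d}. \<Lambda> d * real (X div d) / ln (real d))"
proof -
  define P where "P = {p\<in>{1..X}. prime p \<and> X \<le> p * p}"
  have XN: "real X \<le> N" unfolding X_def using assms by linarith
  have "{1..X} \<subseteq> E N \<union> (\<Union>p\<in>P. (*) p ` {1..X div p})"
  proof
    fix k assume k: "k \<in> {1..X}"
    show "k \<in> E N \<union> (\<Union>p\<in>P. (*) p ` {1..X div p})"
    proof (cases "k \<in> E N")
      case False
      moreover have "real k \<le> N" using k XN by auto
      ultimately have "\<exists>p. prime p \<and> p dvd k \<and> sqrt N \<le> real p"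
        using k by (auto simp: E_def not_less)
      then obtain p where p: "prime p" "p dvd k" "sqrt N \<le> real p" by blast
      obtain m where m: "k = p * m" using p by auto
      have p0: "p > 0" using p prime_gt_0_nat by blast
      have "N \<le> real p * real p" using p(3) assms
        mult_mono[OF p(3) p(3)] by simp
      hence "real X \<le> real (p * p)" using XN by simp
      hence "X \<le> p * p" by (simp only: of_nat_le_iff)
      moreover have "p \<le> X" using p k by (auto dest: dvd_imp_le)
      ultimately have "p \<in> P" using p p0 by (auto simp: P_def)
      moreover have "m * p \<le> X" "m \<noteq> 0" using k m by (auto simp: mult.commute)
      hence "m \<in> {1..X div p}" using p0 by (simp add: less_eq_div_iff_mult_less_eq)
      ultimately show ?thesis using m by blast
    qed auto
  qed
  hence "card {1..X} \<le> card (E N \<union> (\<Union>p\<in>P. (*) p ` {1..X div p}))"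
    by (intro card_mono) (auto simp: finite_E P_def)
  also have "\<dots> \<le> card (E N) + card (\<Union>p\<in>P. (*) p ` {1..X div p})" by (rule card_Un_le)
  also have "card (\<Union>p\<in>P. (*) p ` {1..X div p}) \<le> (\<Sum>p\<in>P. card ((*) p ` {1..X div p}))"
    by (intro card_UN_le) (auto simp: P_def)
  also have "\<dots> \<le> (\<Sum>p\<in>P. card {1..X div p})" by (intro sum_mono card_image_le) auto
  finally have "X \<le> card (E N) + (\<Sum>p\<in>P. X div p)" by simp
  hence "real X \<le> real (card (E N) + (\<Sum>p\<in>P. X div p))" by (simp only: of_nat_le_iff)
  also have "\<dots> = real (card (E N)) + (\<Sum>p\<in>P. real (X div p))" by simp
  also have "(\<Sum>p\<in>P. real (X div p)) = (\<Sum>p\<in>P. \<Lambda> p * real (X div p) / ln (real p))"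
  proof (intro sum.cong refl)
    fix p assume "p \<in> P"
    hence "prime p" by (simp add: P_def)
    moreover from this have "ln (real p) > 0" using prime_gt_1_nat[of p] by simp
    ultimately show "real (X div p) = \<Lambda> p * real (X div p) / ln (real p)" by simp
  qed
  also have "\<dots> \<le> (\<Sum>d\<in>{d\<in>{1..X}. X \<le> d * d}. \<Lambda> d * real (X div d) / ln (real d))"
    by (intro sum_mono2 divide_nonneg_nonneg mult_nonneg_nonneg) (auto simp: P_def mangoldt_nonneg)
  finally show ?thesis by simp
qed

section \<open>Conclusion for real N\<close>

lemma card_E_gt_eventually: "\<exists>N0. \<forall>N::real. N > 1 \<and> N \<ge> N0 \<longrightarrow> real (card (E N)) > N * ln (exp 1 / 2)"
proof -
  obtain K where K: "\<And>X. X \<ge> K \<Longrightarrow>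
      (\<Sum>d\<in>{d\<in>{1..X}. X \<le> d * d}. \<Lambda> d * real (X div d) / ln (real d)) \<le> real X * ln 2 - 1"
    using sum_large_eventually_le unfolding eventually_sequentially by blast
  have "real (card (E N)) > N * ln (exp 1 / 2)" if N: "N > 1" "N \<ge> real K" for N
  proof -
    define X where "X = nat \<lfloor>N\<rfloor>"
    have "X \<ge> K" using N by (simp add: X_def le_nat_floor)
    have NX: "N < real X + 1" using N unfolding X_def by linarith
    have "N * ln (exp 1 / 2) = N * (1 - ln 2)" by (simp add: ln_div)
    also have "\<dots> < (real X + 1) * (1 - ln 2)"
      using NX ln_2_less_1 by (intro mult_strict_right_mono) auto
    \<comment> \<open>The spare 1 absorbs the \<open>1 - ln 2\<close> caused by
      \<open>N < X + 1\<close>.\<close>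
    also have "\<dots> \<le> real X - (real X * ln 2 - 1)" using ln_2_less_1 by (simp add: algebra_simps)
    also have "\<dots> \<le> real (card (E N))" using card_E_ge[OF N(1)] K[OF \<open>X \<ge> K\<close>] by (simp add: X_def)
    finally show ?thesis .
  qed
  thus ?thesis by blast
qed

theorem theorem1p3:
  shows "(\<exists>\<alpha>::real. \<alpha> > 0 \<and> (\<forall>N::real. N > 1 \<longrightarrow> real (card (E N)) > \<alpha> * N))
    \<and> (\<exists>N0::real. \<forall>N::real. N > 1 \<and> N \<ge> N0 \<longrightarrow> real (card (E N)) > N * ln (exp 1 / 2))"
proof
  obtain N0 where N0: "\<And>N::real. N > 1 \<Longrightarrow> N \<ge> N0 \<Longrightarrow> real (card (E N)) > N * ln (exp 1 / 2)"
    using card_E_gt_eventually by blast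
  \<comment> \<open>For \<open>1 < N < N0\<close> the element 1 of \<open>E N\<close> suffices,
    because then \<open>N / K < 1\<close>. The maximum keeps \<open>K\<close> positive whatever
    \<open>N0\<close> is.\<close>
  define K where "K = max N0 1"
  define \<alpha> where "\<alpha> = min (ln (exp 1 / 2)) (1 / K)"
  have "ln (exp 1 / 2 :: real) > 0" using ln_2_less_1 by (simp add: ln_div)
  moreover have "K > 0" by (simp add: K_def)
  ultimately have "\<alpha> > 0" by (simp add: \<alpha>_def)
  moreover have "real (card (E N)) > \<alpha> * N" if N: "N > 1" for N
  proof (cases "N \<ge> N0")
    case True
    have "\<alpha> * N \<le> ln (exp 1 / 2) * N" using N by (intro mult_right_mono) (auto simp: \<alpha>_def)
    also have "\<dots> < real (card (E N))" using N0[OF N True] by (simp add: mult.commute)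
    finally show ?thesis .
  next
    case False
    have "1 \<in> E N" using N by (auto simp: E_def)
    hence "card (E N) > 0" using finite_E[of N] by (auto simp: card_gt_0_iff)
    have "\<alpha> * N \<le> 1 / K * N" using N by (intro mult_right_mono) (auto simp: \<alpha>_def)
    also have "\<dots> < 1" using False \<open>K > 0\<close> by (simp add: K_def)
    also have "1 \<le> real (card (E N))" using \<open>card (E N) > 0\<close> by simp
    finally show ?thesis .
  qed
  ultimately show "\<exists>\<alpha>::real. \<alpha> > 0 \<and> (\<forall>N::real. N > 1 \<longrightarrow> real (card (E N)) > \<alpha> * N)" by blast
qed (rule card_E_gt_eventually)

end
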